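(* Let $A\in\mathbb{R}^{n\times n}$ be nonsingular, with blocks of rows $\bar A_j\in\mathbb{R}^{n_j\times n}$ given by $A^T=[\bar A_1^T\ \bar A_2^T\ \cdots\ \bar A_\ell^T]$, $\sum_{j=1}^\ell n_j=n$. For $j=1,\dots,\ell$ let $\bar A_j\bar A_j^T=\bar R_j^T\bar R_j$ be the Cholesky decomposition ($\bar R_j$ upper triangular) and let $E_j:=\bar R_j^{-T}$. Then $\{E_1,\dots,E_\ell\}$ is an optimal block diagonal scaling with lower triangular blocks for $$\min\ \{\omega((EA)^T(EA)) : E=\operatorname{Blkdiag}(E_1,\dots,E_\ell),\ E_j\in\mathbb{R}^{n_j\times n_j}\ \text{nonsingular}\},$$ i.e. each $E_j$ is lower triangular and $E=\operatorname{Blkdiag}(E_1,\dots,E_\ell)$ attains the minimum.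
   Context: For a symmetric positive definite $n\times n$ matrix $S$, $\omega(S)=\dfrac{\operatorname{trace}(S)/n}{\det(S)^{1/n}}$. $\operatorname{Blkdiag}(E_1,\dots,E_\ell)$ is the block diagonal matrix with diagonal blocks $E_1,\dots,E_\ell$. *)

theory Defs
  imports Complex_Main "Jordan_Normal_Form.Gauss_Jordan_Elimination"
    "Jordan_Normal_Form.Determinant"
begin

definition mat_trace :: "'a::comm_monoid_add mat \<Rightarrow> 'a" where
  "mat_trace S = (\<Sum>i<dim_row S. S $$ (i, i))"

text \<open>
  The ratio of the arithmetic to the geometric mean of the eigenvalues. It is meant for
  symmetric positive definite matrices of positive dimension; elsewhere its value is junk.
\<close>
definition omega :: "real mat \<Rightarrow> real" where
  "omega S = (mat_trace S / real (dim_row S)) / root (dim_row S) (det S)"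

definition lower_triangular :: "'a::zero mat \<Rightarrow> bool" where
  "lower_triangular L \<longleftrightarrow> (\<forall>i<dim_row L. \<forall>j<dim_col L. i < j \<longrightarrow> L $$ (i, j) = 0)"

text \<open>
  Positivity of the diagonal is the usual normalization that makes the Cholesky factor of a
  symmetric positive definite matrix unique.
\<close>
definition cholesky_factor :: "real mat \<Rightarrow> real mat \<Rightarrow> bool" where
  "cholesky_factor S R \<longleftrightarrow>
     R \<in> carrier_mat (dim_row S) (dim_row S) \<and>
     upper_triangular R \<and> (\<forall>i<dim_row R. R $$ (i, i) > 0) \<and>
     S = transpose_mat R * R"

definition block_scalings :: "nat list \<Rightarrow> real mat set" where
  "block_scalings ns =
     {diag_block_mat Es |Es. length Es = length ns \<and>
        (\<forall>j<length ns. Es ! j \<in> carrier_mat (ns ! j) (ns ! j) \<and> invertible_mat (Es ! j))}"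

end

theory Submission
  imports Defs "Jordan_Normal_Form.Schur_Decomposition"
begin

text \<open>
  Let \<open>L\<close> be the block diagonal matrix of the transposed Cholesky factors, so that the claimed
  optimal scaling is its inverse. The trace of \<open>(FA)\<^sup>T(FA)\<close> equals that of \<open>(FA)(FA)\<^sup>T\<close>, which for a
  block diagonal \<open>F\<close> depends only on the diagonal blocks of \<open>AA\<^sup>T\<close>; these agree with those of \<open>LL\<^sup>T\<close>.
  Hence replacing \<open>A\<close> by \<open>L\<close> changes \<open>\<omega>\<close> only by a factor coming from the determinants,
  which does not depend on \<open>F\<close>. By the inequality of arithmetic and geometric means, applied to the
  eigenvalues of \<open>(FL)\<^sup>T(FL)\<close>, the value at \<open>FL\<close> is at least 1, with equality for \<open>FL = 1\<close>.
\<close>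

section \<open>Traces under cyclic permutation, similarity and block decomposition\<close>

lemma mat_trace_mult_comm:
  fixes A B :: "'a::comm_semiring_0 mat"
  assumes A: "A \<in> carrier_mat n m" and B: "B \<in> carrier_mat m n"
  shows "mat_trace (A * B) = mat_trace (B * A)"
proof -
  have "mat_trace (A * B) = (\<Sum>i<n. \<Sum>j<m. A $$ (i, j) * B $$ (j, i))"
    using A B by (auto simp: mat_trace_def scalar_prod_def atLeast0LessThan intro!: sum.cong)
  also have "\<dots> = (\<Sum>j<m. \<Sum>i<n. B $$ (j, i) * A $$ (i, j))"
    by (subst sum.swap) (simp add: mult.commute)
  also have "\<dots> = mat_trace (B * A)"
    using A B by (auto simp: mat_trace_def scalar_prod_def atLeast0LessThan intro!: sum.cong)
  finally show ?thesis .
qed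

lemma mat_trace_similar:
  fixes A B :: "'a::comm_ring_1 mat"
  assumes "similar_mat A B"
  shows "mat_trace A = mat_trace B"
proof -
  from similar_matD[OF assms] obtain n P Q where
    carr: "{A, B, P, Q} \<subseteq> carrier_mat n n" and QP: "Q * P = 1\<^sub>m n" and A: "A = P * B * Q"
    by blast
  have "mat_trace A = mat_trace (P * (B * Q))"
    using carr A by auto
  also have "\<dots> = mat_trace (B * Q * P)"
    using carr by (intro mat_trace_mult_comm) auto
  also have "B * Q * P = B"
    using carr QP by auto
  finally show ?thesis .
qed

lemma mat_trace_four_block_mat:
  assumes "A \<in> carrier_mat n n" "D \<in> carrier_mat m m"
  shows "mat_trace (four_block_mat A B C D) = mat_trace A + mat_trace D"
proof -
  have "mat_trace (four_block_mat A B C D)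
      = (\<Sum>i<n + m. if i < n then A $$ (i, i) else D $$ (i - n, i - n))"
    using assms by (auto simp: mat_trace_def intro!: sum.cong)
  also have "\<dots> = (\<Sum>i<n. A $$ (i, i)) + (\<Sum>i<m. D $$ (i, i))"
    by (induction m) (simp_all add: ac_simps)
  also have "\<dots> = mat_trace A + mat_trace D"
    using assms by (simp add: mat_trace_def)
  finally show ?thesis .
qed

section \<open>Determinant and trace of a real Gram matrix\<close>

text \<open>For an eigenvector \<open>v\<close>, \<open>e\<close> times the squared norm of
  \<open>v\<close> is the squared norm of \<open>G v\<close>, so \<open>e\<close> is a quotient of
  nonnegative reals. In the order on complex numbers, \<open>0 \<le> e\<close> also says that
  \<open>e\<close> is real.\<close>

lemma eigenvalue_of_real_gram_nonneg:
  fixes G :: "real mat" and e :: complex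
  assumes G: "G \<in> carrier_mat n n"
    and e: "eigenvalue (map_mat of_real (transpose_mat G * G)) e"
  shows "0 \<le> e"
proof -
  let ?G = "map_mat complex_of_real G"
  have Gc: "?G \<in> carrier_mat n n" using G by simp
  have S: "map_mat complex_of_real (transpose_mat G * G) = transpose_mat ?G * ?G"
    using G by (auto simp: of_real_hom.mat_hom_mult[of _ n n _ n] map_mat_transpose)
  from e obtain v where v: "v \<in> carrier_vec n" and v0: "v \<noteq> 0\<^sub>v n"
    and ev: "(transpose_mat ?G * ?G) *\<^sub>v v = e \<cdot>\<^sub>v v"
    unfolding S eigenvalue_def eigenvector_def using G by auto
  \<comment> \<open>Since \<open>G\<close> is real, its transpose acts as the adjoint for the
    complex inner product.\<close>
  have conj: "conjugate (?G *\<^sub>v v) = ?G *\<^sub>v conjugate v"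
    using G v by (intro eq_vecI) (auto simp: scalar_prod_def)
  have "e * (v \<bullet>c v) = (e \<cdot>\<^sub>v v) \<bullet>c v"
    using v by simp
  also have "\<dots> = (transpose_mat ?G *\<^sub>v (?G *\<^sub>v v)) \<bullet>c v"
    unfolding ev[symmetric] using Gc v by (subst assoc_mult_mat_vec) auto
  also have "\<dots> = (?G *\<^sub>v v) \<bullet> (?G *\<^sub>v conjugate v)"
    using Gc v by (intro transpose_vec_mult_scalar) auto
  also have "\<dots> = (?G *\<^sub>v v) \<bullet>c (?G *\<^sub>v v)"
    by (simp add: conj)
  finally have eq: "e * (v \<bullet>c v) = (?G *\<^sub>v v) \<bullet>c (?G *\<^sub>v v)" .
  have pos: "0 < v \<bullet>c v"
    using v v0 by simp
  have "e = ((?G *\<^sub>v v) \<bullet>c (?G *\<^sub>v v)) / (v \<bullet>c v)"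
    using eq pos by (auto simp: field_simps)
  moreover have "0 \<le> (?G *\<^sub>v v) \<bullet>c (?G *\<^sub>v v)"
    by (rule conjugate_square_ge_0_vec)
  ultimately show ?thesis
    using pos by (auto simp: less_eq_complex_def less_complex_def Re_divide Im_divide)
qed

text \<open>Polya's proof: apply \<open>1 + t \<le> exp t\<close> with \<open>t = y / m - 1\<close>
  to each entry \<open>y\<close>, where \<open>m\<close> is the mean, and multiply. The exponents
  add up to zero.\<close>

lemma prod_list_le_mean_power:
  fixes xs :: "real list"
  assumes "\<forall>x\<in>set xs. 0 \<le> x" and "xs \<noteq> []"
  shows "prod_list xs \<le> (sum_list xs / real (length xs)) ^ length xs"
proof (cases "sum_list xs = 0")
  \<comment> \<open>A zero mean cannot serve as a divisor, so this case is separate: all entries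
    vanish.\<close>
  case True
  with assms have "\<forall>x\<in>set xs. x = 0"
    by (subst (asm) sum_list_nonneg_eq_0_iff) auto
  with assms(2) have "prod_list xs = 0"
    by (cases xs) auto
  then show ?thesis
    using True assms(2) by (simp only:) (simp add: zero_power)
next
  case False
  define m where "m = sum_list xs / real (length xs)"
  have "0 < sum_list xs"
    using False assms(1) by (metis less_eq_real_def sum_list_nonneg)
  then have m: "0 < m" using assms(2) by (simp add: m_def)
  \<comment> \<open>The list varies while \<open>m\<close> stays fixed, so the exponent cancels only
    for \<open>ys = xs\<close>. Nonnegativity is carried along because multiplying the inequalities
    requires it.\<close>
  have bound: "0 \<le> prod_list ys \<and> prod_list ys \<le> exp (sum_list ys / m - real (length ys)) * m ^ length ys"
    if "\<forall>x\<in>set ys. 0 \<le> x" for ys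
    using that
  proof (induction ys)
    case (Cons y ys)
    have "y / m \<le> exp (y / m - 1)"
      using exp_ge_add_one_self[of "y / m - 1"] by simp
    then have "y \<le> exp (y / m - 1) * m"
      using m by (simp add: field_simps)
    then have "y * prod_list ys
        \<le> (exp (y / m - 1) * m) * (exp (sum_list ys / m - real (length ys)) * m ^ length ys)"
      using Cons m by (intro mult_mono) auto
    also have "\<dots> = exp (sum_list (y # ys) / m - real (length (y # ys))) * m ^ length (y # ys)"
      by (simp add: add_divide_distrib mult_exp_exp algebra_simps)
    finally show ?case using Cons by auto
  qed auto
  have "sum_list xs / m = real (length xs)"
    using False assms(2) by (simp add: m_def)
  with bound[OF assms(1)] have "prod_list xs \<le> m ^ length xs" by simp
  then show ?thesis unfolding m_def .
qed

text \<open>Over the complex numbers the characteristic polynomial splits, and a triangular Schur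
  form exhibits determinant and trace as product and sum of the eigenvalues. These are nonnegative,
  so the mean inequality applies.\<close>

lemma det_gram_le_mean_power:
  fixes G :: "real mat"
  assumes G: "G \<in> carrier_mat n n" and n: "0 < n"
  shows "det (transpose_mat G * G) \<le> (mat_trace (transpose_mat G * G) / real n) ^ n"
proof -
  let ?S = "transpose_mat G * G"
  let ?C = "map_mat complex_of_real ?S"
  have S: "?S \<in> carrier_mat n n" and C: "?C \<in> carrier_mat n n"
    using G by auto
  from char_poly_factorized[OF C] obtain es
    where cp: "char_poly ?C = (\<Prod>a\<leftarrow>es. [:- a, 1:])" and len: "length es = n"
    by blast
  obtain B P Q where "schur_decomposition ?C es = (B, P, Q)"
    by (cases "schur_decomposition ?C es")
  from schur_decomposition[OF C cp this] have sim: "similar_mat ?C B"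
    and ut: "upper_triangular B" and diag: "diag_mat B = es"
    unfolding similar_mat_def by auto
  have B: "B \<in> carrier_mat n n"
    using similar_matD[OF sim] C by auto
  have ge: "0 \<le> e" if "e \<in> set es" for e
  proof (rule eigenvalue_of_real_gram_nonneg[OF G])
    show "eigenvalue ?C e"
      unfolding eigenvalue_root_char_poly[OF C] cp using that
      by (auto simp: poly_prod_list prod_list_zero_iff)
  qed
  \<comment> \<open>Nonnegative complex numbers are real, so taking real parts loses nothing and the
    identities descend to the reals.\<close>
  define rs where "rs = map Re es"
  have es: "es = map complex_of_real rs"
    unfolding rs_def map_map by (rule map_idI[symmetric])
      (use ge in \<open>auto simp: less_eq_complex_def complex_eq_iff\<close>)
  have "complex_of_real (det ?S) = prod_list es"
    using det_similar[OF sim] det_upper_triangular[OF ut B] diag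
    by (simp add: of_real_hom.hom_det)
  then have det: "det ?S = prod_list rs"
    unfolding es of_real_hom.hom_prod_list[symmetric] of_real_eq_iff .
  have "complex_of_real (mat_trace ?S) = mat_trace ?C"
    by (simp add: mat_trace_def)
  also have "\<dots> = mat_trace B"
    by (rule mat_trace_similar[OF sim])
  also have "\<dots> = sum_list (diag_mat B)"
    by (simp add: mat_trace_def diag_mat_def interv_sum_list_conv_sum_set_nat atLeast0LessThan)
  finally have tr: "mat_trace ?S = sum_list rs"
    unfolding diag es of_real_hom.hom_sum_list[symmetric] of_real_eq_iff .
  have "\<forall>r\<in>set rs. 0 \<le> r"
    using ge by (auto simp: rs_def less_eq_complex_def)
  from prod_list_le_mean_power[OF this] len n show ?thesis
    unfolding det tr by (auto simp: rs_def)
qed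

lemma omega_gram_ge_1:
  assumes G: "G \<in> carrier_mat n n" and n: "0 < n" and d: "det G \<noteq> 0"
  shows "1 \<le> omega (transpose_mat G * G)"
proof -
  let ?S = "transpose_mat G * G"
  have dim: "dim_row ?S = n" using G by simp
  have "det ?S = (det G)\<^sup>2"
    using G by (simp add: det_mult[of _ n] det_transpose power2_eq_square)
  then have pos: "0 < det ?S" using d by simp
  have "0 \<le> mat_trace ?S"
    using G by (auto simp: mat_trace_def scalar_prod_def intro!: sum_nonneg)
  then have "root n (det ?S) \<le> mat_trace ?S / real n"
    using det_gram_le_mean_power[OF G n] n
    by (metis divide_nonneg_nonneg of_nat_0_le_iff real_root_le_mono real_root_power_cancel)
  then show ?thesis
    unfolding omega_def dim using pos n by (simp add: real_root_gt_zero field_simps)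
qed

section \<open>Block diagonal matrices and stacked rows\<close>

lemma diag_block_mat_carrier:
  assumes "list_all2 (\<lambda>M k. M \<in> carrier_mat k k) Ms ns"
  shows "diag_block_mat Ms \<in> carrier_mat (sum_list ns) (sum_list ns)"
  using assms by induction (auto simp: Let_def)

lemma foldr_append_rows_carrier:
  assumes "list_all2 (\<lambda>M k. M \<in> carrier_mat k n) Ms ns"
  shows "foldr append_rows Ms (0\<^sub>m 0 n) \<in> carrier_mat (sum_list ns) n"
  using assms by induction auto

lemma diag_block_mat_Cons_mult:
  fixes F L :: "'a::semiring_0 mat"
  assumes "F \<in> carrier_mat k k" "L \<in> carrier_mat k k"
    "list_all2 (\<lambda>M k. M \<in> carrier_mat k k) Fs ns" "list_all2 (\<lambda>M k. M \<in> carrier_mat k k) Ls ns"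
  shows "diag_block_mat (F # Fs) * diag_block_mat (L # Ls)
    = four_block_mat (F * L) (0\<^sub>m k (sum_list ns)) (0\<^sub>m (sum_list ns) k)
        (diag_block_mat Fs * diag_block_mat Ls)"
proof -
  note D = diag_block_mat_carrier[OF assms(3)] diag_block_mat_carrier[OF assms(4)]
  show ?thesis
    using assms(1,2) D
    by (simp add: Let_def, subst mult_four_block_mat[where ?n1.0 = k and ?n2.0 = "sum_list ns"]) auto
qed

lemma diag_block_mat_inverse:
  fixes Fs Ls :: "'a::semiring_1 mat list"
  assumes "list_all2 (\<lambda>M k. M \<in> carrier_mat k k) Fs ns" "list_all2 (\<lambda>M k. M \<in> carrier_mat k k) Ls ns"
    and "list_all2 (\<lambda>F L. F * L = 1\<^sub>m (dim_row F)) Fs Ls"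
  shows "diag_block_mat Fs * diag_block_mat Ls = 1\<^sub>m (sum_list ns)"
  using assms
proof (induction ns arbitrary: Fs Ls rule: list.induct)
  case (Cons k ns)
  then obtain F Fs' L Ls' where "Fs = F # Fs'" "Ls = L # Ls'"
    by (auto simp: list_all2_Cons2)
  with Cons show ?case
    by (simp only:) (subst diag_block_mat_Cons_mult[where k = k and ns = ns], auto)
qed auto

lemma four_block_diag_mult_append_rows:
  fixes F A :: "'a::semiring_0 mat"
  assumes "F \<in> carrier_mat k k" "A \<in> carrier_mat k n"
    "D \<in> carrier_mat m m" "B \<in> carrier_mat m n"
  shows "four_block_mat F (0\<^sub>m k m) (0\<^sub>m m k) D * (A @\<^sub>r B) = (F * A) @\<^sub>r (D * B)"
  using assms unfolding append_rows_def
  by (subst mult_four_block_mat[where ?n1.0 = k and ?n2.0 = m and ?nr1.0 = k and ?nr2.0 = m]) auto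

text \<open>The mixed products of \<open>A\<close> and \<open>B\<close> land in off-diagonal blocks,
  which the trace does not see.\<close>

lemma mat_trace_append_rows_gram:
  fixes A B :: "'a::semiring_0 mat"
  assumes "A \<in> carrier_mat k n" "B \<in> carrier_mat m n"
  shows "mat_trace ((A @\<^sub>r B) * transpose_mat (A @\<^sub>r B))
    = mat_trace (A * transpose_mat A) + mat_trace (B * transpose_mat B)"
proof -
  have "(A @\<^sub>r B) * transpose_mat (A @\<^sub>r B)
    = four_block_mat (A * transpose_mat A) (A * transpose_mat B)
        (B * transpose_mat A) (B * transpose_mat B)"
    using assms unfolding append_rows_def
    \<comment> \<open>\<open>append_rows\<close> is a four-block matrix whose right blocks have zero
      columns.\<close>
    by (subst transpose_four_block_mat[where ?nr1.0 = k and ?nc1.0 = n and ?nr2.0 = m and ?nc2.0 = 0])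
      (auto simp: mult_four_block_mat[where ?nr1.0 = k and ?n1.0 = n and ?n2.0 = 0 and ?nr2.0 = m and ?nc1.0 = k and ?nc2.0 = m])
  then show ?thesis
    using assms by (simp add: mat_trace_four_block_mat[of _ k _ m])
qed

lemma mat_trace_diag_gram:
  fixes A B :: "'a::semiring_0 mat"
  assumes "A \<in> carrier_mat k k" "B \<in> carrier_mat m m"
  defines "X \<equiv> four_block_mat A (0\<^sub>m k m) (0\<^sub>m m k) B"
  shows "mat_trace (X * transpose_mat X)
    = mat_trace (A * transpose_mat A) + mat_trace (B * transpose_mat B)"
proof -
  have "X * transpose_mat X
    = four_block_mat (A * transpose_mat A) (0\<^sub>m k m) (0\<^sub>m m k) (B * transpose_mat B)"
    using assms(1,2) unfolding X_def
    by (subst transpose_four_block_mat[where ?nr1.0 = k and ?nc1.0 = k and ?nr2.0 = m and ?nc2.0 = m])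
      (auto simp: mult_four_block_mat[where ?nr1.0 = k and ?n1.0 = k and ?n2.0 = m and ?nr2.0 = m and ?nc1.0 = k and ?nc2.0 = m])
  then show ?thesis
    using assms by (simp add: mat_trace_four_block_mat[of _ k _ m])
qed

text \<open>Isolates \<open>A * transpose_mat A\<close>, so that matrices with the same Gram matrix
  of rows become interchangeable.\<close>

lemma gram_mult:
  fixes F A :: "'a::comm_semiring_0 mat"
  assumes "F \<in> carrier_mat k m" "A \<in> carrier_mat m n"
  shows "(F * A) * transpose_mat (F * A) = F * (A * transpose_mat A) * transpose_mat F"
  using assms
  by (simp add: transpose_mult[of _ k m _ n] assoc_mult_mat[of _ k m _ n _ k]
      assoc_mult_mat[of _ m n _ m _ k] assoc_mult_mat[of _ k m _ m _ k])

text \<open>A block scaling only sees the diagonal blocks of the Gram matrix of the rows, so the rows may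
  be replaced by any block diagonal matrix with the same diagonal blocks.\<close>

lemma mat_trace_block_scaling:
  fixes Fs As Ls :: "'a::comm_semiring_0 mat list"
  assumes "list_all2 (\<lambda>M k. M \<in> carrier_mat k k) Fs ns"
    and "list_all2 (\<lambda>M k. M \<in> carrier_mat k n) As ns"
    and "list_all2 (\<lambda>M k. M \<in> carrier_mat k k) Ls ns"
    and "list_all2 (\<lambda>A L. A * transpose_mat A = L * transpose_mat L) As Ls"
  defines "X \<equiv> diag_block_mat Fs * foldr append_rows As (0\<^sub>m 0 n)"
    and "Y \<equiv> diag_block_mat Fs * diag_block_mat Ls"
  shows "mat_trace (X * transpose_mat X) = mat_trace (Y * transpose_mat Y)"
  using assms(1-4) unfolding X_def Y_def
\<comment> \<open>The column count \<open>n\<close> is kept apart from \<open>sum_list ns\<close>: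
  the tail of the row blocks still has \<open>n\<close> columns, so the stacked matrix need not be
  square.\<close>
proof (induction ns arbitrary: Fs As Ls rule: list.induct)
  case Nil
  then show ?case by (simp add: mat_trace_def)
next
  case (Cons k ns)
  from Cons.prems obtain F Fs' A As' L Ls'
    where l: "Fs = F # Fs'" "As = A # As'" "Ls = L # Ls'"
      and c: "F \<in> carrier_mat k k" "A \<in> carrier_mat k n" "L \<in> carrier_mat k k"
      and cs: "list_all2 (\<lambda>M k. M \<in> carrier_mat k k) Fs' ns"
        "list_all2 (\<lambda>M k. M \<in> carrier_mat k n) As' ns"
        "list_all2 (\<lambda>M k. M \<in> carrier_mat k k) Ls' ns"
        "list_all2 (\<lambda>A L. A * transpose_mat A = L * transpose_mat L) As' Ls'"
      and g: "A * transpose_mat A = L * transpose_mat L"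
    by (auto simp: list_all2_Cons2)
  note D = diag_block_mat_carrier[OF cs(1)] diag_block_mat_carrier[OF cs(3)]
    foldr_append_rows_carrier[OF cs(2)]
  have "diag_block_mat Fs * foldr append_rows As (0\<^sub>m 0 n)
    = (F * A) @\<^sub>r (diag_block_mat Fs' * foldr append_rows As' (0\<^sub>m 0 n))"
    using four_block_diag_mult_append_rows[OF c(1,2) D(1,3)] c D by (simp add: l Let_def)
  then have 1: "mat_trace ((diag_block_mat Fs * foldr append_rows As (0\<^sub>m 0 n))
        * transpose_mat (diag_block_mat Fs * foldr append_rows As (0\<^sub>m 0 n)))
    = mat_trace ((F * A) * transpose_mat (F * A))
      + mat_trace ((diag_block_mat Fs' * foldr append_rows As' (0\<^sub>m 0 n))
        * transpose_mat (diag_block_mat Fs' * foldr append_rows As' (0\<^sub>m 0 n)))"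
    using c D by (simp add: mat_trace_append_rows_gram[of _ k n _ "sum_list ns"])
  have 2: "mat_trace ((diag_block_mat Fs * diag_block_mat Ls)
        * transpose_mat (diag_block_mat Fs * diag_block_mat Ls))
    = mat_trace ((F * L) * transpose_mat (F * L))
      + mat_trace ((diag_block_mat Fs' * diag_block_mat Ls')
        * transpose_mat (diag_block_mat Fs' * diag_block_mat Ls'))"
    unfolding l diag_block_mat_Cons_mult[OF c(1,3) cs(1,3)]
    using c D by (intro mat_trace_diag_gram) auto
  show ?case
    unfolding 1 2 Cons.IH[OF cs] gram_mult[OF c(1,2)] gram_mult[OF c(1,3)] g ..
qed

section \<open>Triangular inverses and nonsingularity\<close>

text \<open>Take the rightmost nonzero entry of row \<open>i\<close> of \<open>E\<close> beyond the
  diagonal, in column \<open>j\<close>. In entry \<open>(i, j)\<close> of \<open>E * L\<close> the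
  terms \<open>l < j\<close> vanish because \<open>L\<close> is lower triangular, those with
  \<open>l > j\<close> by maximality. The remaining term is nonzero, but the identity has 0
  there.\<close>

lemma lower_triangular_left_inverse:
  fixes E L :: "'a::idom mat"
  assumes E: "E \<in> carrier_mat k k" and L: "L \<in> carrier_mat k k"
    and low: "lower_triangular L" and nz: "\<forall>i<k. L $$ (i, i) \<noteq> 0"
    and inv: "E * L = 1\<^sub>m k"
  shows "lower_triangular E"
proof (rule ccontr)
  assume "\<not> lower_triangular E"
  then obtain i j0 where i: "i < k" and j0: "j0 < k" "i < j0" "E $$ (i, j0) \<noteq> 0"
    using E unfolding lower_triangular_def by auto
  define J where "J = {j. j < k \<and> i < j \<and> E $$ (i, j) \<noteq> 0}"
  have J: "finite J" "J \<noteq> {}" using j0 by (auto simp: J_def)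
  define j where "j = Max J"
  have "j \<in> J" using Max_in[OF J] by (simp add: j_def)
  then have j: "j < k" "i < j" "E $$ (i, j) \<noteq> 0" by (auto simp: J_def)
  have above: "E $$ (i, l) = 0" if "l < k" "j < l" for l
  proof (rule ccontr)
    assume "E $$ (i, l) \<noteq> 0"
    then have "l \<in> J" using that j by (auto simp: J_def)
    then show False using Max_ge[OF J(1)] that by (fastforce simp: j_def)
  qed
  have "0 = (E * L) $$ (i, j)"
    using i j by (simp add: inv)
  also have "\<dots> = (\<Sum>l<k. E $$ (i, l) * L $$ (l, j))"
    using E L i j by (auto simp: scalar_prod_def atLeast0LessThan intro!: sum.cong)
  also have "\<dots> = (\<Sum>l<k. if l = j then E $$ (i, j) * L $$ (j, j) else 0)"
  proof (rule sum.cong)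
    fix l assume "l \<in> {..<k}"
    then show "E $$ (i, l) * L $$ (l, j) = (if l = j then E $$ (i, j) * L $$ (j, j) else 0)"
      using above low L j unfolding lower_triangular_def by (cases l j rule: linorder_cases) auto
  qed simp
  also have "\<dots> = E $$ (i, j) * L $$ (j, j)"
    using j by simp
  finally show False using j nz by auto
qed

lemma invertible_mat_iff_det:
  fixes A :: "'a::field mat"
  assumes A: "A \<in> carrier_mat n n"
  shows "invertible_mat A \<longleftrightarrow> det A \<noteq> 0"
proof
  assume "invertible_mat A"
  then obtain B where AB: "A * B = 1\<^sub>m n" and BA: "B * A = 1\<^sub>m (dim_row B)"
    using A unfolding invertible_mat_def inverts_mat_def by auto
  \<comment> \<open>\<open>invertible_mat\<close> does not fix the size of its witness; the column
    counts of the two products determine it.\<close>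
  have "B \<in> carrier_mat n n"
    using arg_cong[OF AB, of dim_col] arg_cong[OF BA, of dim_col] A by auto
  then have "det A * det B = 1"
    using AB A by (metis det_mult det_one)
  then show "det A \<noteq> 0" by auto
next
  assume "det A \<noteq> 0"
  from det_non_zero_imp_unit[OF A this, of undefined]
  obtain B where "B \<in> carrier_mat n n" "B * A = 1\<^sub>m n" "A * B = 1\<^sub>m n"
    unfolding Units_def ring_mat_def by auto
  then show "invertible_mat A"
    using A unfolding invertible_mat_def inverts_mat_def by auto
qed

lemma det_diag_block_mat_nonzero:
  fixes Fs :: "'a::idom mat list"
  assumes "list_all2 (\<lambda>M k. M \<in> carrier_mat k k \<and> det M \<noteq> 0) Fs ns"
  shows "det (diag_block_mat Fs) \<noteq> 0"
  using assms
proof induction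
  case (Cons F Fs k ns)
  have "diag_block_mat Fs \<in> carrier_mat (sum_list ns) (sum_list ns)"
    using Cons.hyps(2) by (intro diag_block_mat_carrier) (auto elim: list_all2_mono)
  then show ?case
    using Cons by (auto simp: Let_def det_four_block_mat_upper_right_zero[of F k _ "sum_list ns"])
qed auto

text \<open>A nonzero determinant rules out the result \<open>None\<close>, for which
  \<open>the\<close> would be unspecified.\<close>

lemma the_mat_inverse:
  fixes A :: "'a::field mat"
  assumes A: "A \<in> carrier_mat n n" and d: "det A \<noteq> 0"
  shows "the (mat_inverse A) \<in> carrier_mat n n \<and> the (mat_inverse A) * A = 1\<^sub>m n"
  using mat_inverse(1)[OF A, where b = "()"] mat_inverse(2)[OF A] det_non_zero_imp_unit[OF A d, of "()"] by (cases "mat_inverse A") auto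

section \<open>Comparison with the block diagonal model and optimality\<close>

text \<open>The traces on both sides agree, and in the quotient of the determinants
  \<open>det F\<close> cancels, which leaves a factor independent of the scaling.\<close>

lemma omega_block_scaling:
  fixes Fs As Ls :: "real mat list"
  assumes Fs: "list_all2 (\<lambda>M k. M \<in> carrier_mat k k) Fs ns"
    and As: "list_all2 (\<lambda>M k. M \<in> carrier_mat k n) As ns"
    and Ls: "list_all2 (\<lambda>M k. M \<in> carrier_mat k k) Ls ns"
    and gram: "list_all2 (\<lambda>A L. A * transpose_mat A = L * transpose_mat L) As Ls"
    and n: "sum_list ns = n"
  defines "F \<equiv> diag_block_mat Fs" and "A \<equiv> foldr append_rows As (0\<^sub>m 0 n)"
    and "L \<equiv> diag_block_mat Ls"
  assumes dL: "det L \<noteq> 0" and n0: "0 < n"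
  shows "omega (transpose_mat (F * A) * (F * A))
    = omega (transpose_mat (F * L) * (F * L)) * root n ((det L / det A)\<^sup>2)"
proof -
  have F: "F \<in> carrier_mat n n" and A: "A \<in> carrier_mat n n" and L: "L \<in> carrier_mat n n"
    using diag_block_mat_carrier[OF Fs] diag_block_mat_carrier[OF Ls] foldr_append_rows_carrier[OF As]
    by (auto simp: F_def A_def L_def n)
  have det: "det (transpose_mat (F * M) * (F * M)) = (det F)\<^sup>2 * (det M)\<^sup>2"
    if "M \<in> carrier_mat n n" for M
  proof -
    have "det (transpose_mat (F * M) * (F * M)) = (det (F * M))\<^sup>2"
      using F that by (simp add: det_mult[of _ n] det_transpose[of _ n] power2_eq_square)
    then show ?thesis using F that by (simp add: det_mult power_mult_distrib)
  qed
  have tr: "mat_trace (transpose_mat (F * M) * (F * M)) = mat_trace ((F * M) * transpose_mat (F * M))"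
    if "M \<in> carrier_mat n n" for M
    using F that by (intro mat_trace_mult_comm) auto
  have "mat_trace (transpose_mat (F * A) * (F * A)) = mat_trace (transpose_mat (F * L) * (F * L))"
    unfolding tr[OF A] tr[OF L] unfolding F_def A_def L_def
    using Fs As Ls gram by (rule mat_trace_block_scaling)
  moreover have "dim_row (transpose_mat (F * M) * (F * M)) = n" if "M \<in> carrier_mat n n" for M
    using F that by simp
  \<comment> \<open>By the convention \<open>x / 0 = 0\<close>, both sides are 0 when
    \<open>det F\<close> or \<open>det A\<close> vanishes.\<close>
  ultimately show ?thesis
    unfolding omega_def using A L dL n0
    by (simp add: det real_root_mult real_root_divide power_divide)
qed

theorem corollary3p13:
  fixes n :: nat and ns :: "nat list"
    and A :: "real mat" and As Rs Es :: "real mat list"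
  assumes "n > 0"
    and "A \<in> carrier_mat n n" and "invertible_mat A"
    and "\<forall>j<length ns. ns ! j > 0" and "sum_list ns = n"
    and "length As = length ns"
    and "\<forall>j<length ns. As ! j \<in> carrier_mat (ns ! j) n"
    and "A = foldr append_rows As (0\<^sub>m 0 n)"
    and "length Rs = length ns"
    and "\<forall>j<length ns. cholesky_factor (As ! j * transpose_mat (As ! j)) (Rs ! j)"
    and "Es = map (\<lambda>R. the (mat_inverse (transpose_mat R))) Rs"
  shows "(\<forall>j<length ns. Es ! j \<in> carrier_mat (ns ! j) (ns ! j) \<and>
            invertible_mat (Es ! j) \<and> lower_triangular (Es ! j)) \<and>
         is_arg_min (\<lambda>E. omega (transpose_mat (E * A) * (E * A)))
           (\<lambda>E. E \<in> block_scalings ns) (diag_block_mat Es)"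
proof -
  \<comment> \<open>Transposition turns the Cholesky identity into equality of the row Gram matrices
    of \<open>As ! j\<close> and \<open>Ls ! j\<close>, and makes \<open>Es ! j\<close> the inverse
    of \<open>Ls ! j\<close>.\<close>
  define Ls where "Ls = map transpose_mat Rs"
  have block: "Ls ! j \<in> carrier_mat (ns ! j) (ns ! j) \<and> det (Ls ! j) \<noteq> 0 \<and>
      As ! j * transpose_mat (As ! j) = Ls ! j * transpose_mat (Ls ! j) \<and>
      Es ! j \<in> carrier_mat (ns ! j) (ns ! j) \<and> Es ! j * Ls ! j = 1\<^sub>m (dim_row (Es ! j)) \<and>
      det (Es ! j) \<noteq> 0 \<and> lower_triangular (Es ! j)"
    if j: "j < length ns" for j
  proof -
    let ?R = "Rs ! j" and ?k = "ns ! j"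
    have Lj: "Ls ! j = transpose_mat ?R" and Ej: "Es ! j = the (mat_inverse (transpose_mat ?R))"
      using j assms(9,11) by (auto simp: Ls_def)
    have chol: "cholesky_factor (As ! j * transpose_mat (As ! j)) ?R" and "As ! j \<in> carrier_mat ?k n"
      using assms(7,10) j by auto
    then have R: "?R \<in> carrier_mat ?k ?k" and ut: "upper_triangular ?R"
      and pos: "\<forall>i<?k. 0 < ?R $$ (i, i)"
      and gram: "As ! j * transpose_mat (As ! j) = transpose_mat ?R * ?R"
      unfolding cholesky_factor_def by auto
    have "det ?R \<noteq> 0"
      using pos R upper_triangular_imp_det_eq_0_iff[OF R ut] by (force simp: diag_mat_def)
    then have L: "Ls ! j \<in> carrier_mat ?k ?k" and dL: "det (Ls ! j) \<noteq> 0"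
      using R by (auto simp: Lj det_transpose)
    have E: "Es ! j \<in> carrier_mat ?k ?k" and inv: "Es ! j * Ls ! j = 1\<^sub>m ?k"
      using the_mat_inverse[OF L dL] by (auto simp: Ej Lj)
    have "det (Es ! j) * det (Ls ! j) = 1"
      using det_mult[OF E L] inv by simp
    moreover have "lower_triangular (Ls ! j)"
      using R ut unfolding lower_triangular_def Lj by (auto simp: upper_triangular_def)
    then have "lower_triangular (Es ! j)"
      using lower_triangular_left_inverse[OF E L _ _ inv] pos R by (fastforce simp: Lj)
    ultimately show ?thesis using E L inv dL gram by (auto simp: Lj)
  qed
  have len: "length Ls = length ns" "length Es = length ns"
    using assms(9,11) by (auto simp: Ls_def)
  have blocks: "\<forall>j<length ns. Es ! j \<in> carrier_mat (ns ! j) (ns ! j) \<and>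
      invertible_mat (Es ! j) \<and> lower_triangular (Es ! j)"
    using block invertible_mat_iff_det by blast
  have As: "list_all2 (\<lambda>M k. M \<in> carrier_mat k n) As ns"
    and Ls: "list_all2 (\<lambda>M k. M \<in> carrier_mat k k) Ls ns"
    and Es: "list_all2 (\<lambda>M k. M \<in> carrier_mat k k) Es ns"
    and gram: "list_all2 (\<lambda>A L. A * transpose_mat A = L * transpose_mat L) As Ls"
    and inv: "list_all2 (\<lambda>E L. E * L = 1\<^sub>m (dim_row E)) Es Ls"
    using assms(6,7) len block by (auto simp: list_all2_conv_all_nth)
  let ?L = "diag_block_mat Ls"
  \<comment> \<open>The factor of \<open>omega_block_scaling\<close>, which turns out to be the
    minimum value.\<close>
  let ?c = "root n ((det ?L / det A)\<^sup>2)"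
  have L: "?L \<in> carrier_mat n n"
    using diag_block_mat_carrier[OF Ls] assms(5) by simp
  have dL: "det ?L \<noteq> 0"
    using block len by (intro det_diag_block_mat_nonzero[of _ ns]) (auto simp: list_all2_conv_all_nth)
  have omega: "omega (transpose_mat (diag_block_mat Fs * A) * (diag_block_mat Fs * A))
    = omega (transpose_mat (diag_block_mat Fs * ?L) * (diag_block_mat Fs * ?L)) * ?c"
    if "list_all2 (\<lambda>M k. M \<in> carrier_mat k k) Fs ns" for Fs
    using omega_block_scaling[OF that As Ls gram assms(5) dL assms(1)] unfolding assms(8)[symmetric] .
  have "diag_block_mat Es * ?L = 1\<^sub>m n"
    using diag_block_mat_inverse[OF Es Ls inv] assms(5) by simp
  \<comment> \<open>The identity matrix has \<open>omega\<close> equal to 1, so only the factor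
    remains.\<close>
  then have opt: "omega (transpose_mat (diag_block_mat Es * A) * (diag_block_mat Es * A)) = ?c"
    unfolding omega[OF Es] using assms(1) by (simp add: omega_def mat_trace_def)
  have "diag_block_mat Es \<in> block_scalings ns"
    unfolding block_scalings_def using len blocks by blast
  moreover have "?c \<le> omega (transpose_mat (E * A) * (E * A))" if "E \<in> block_scalings ns" for E
  proof -
    from that obtain Fs where E: "E = diag_block_mat Fs" and "length Fs = length ns"
      and "\<forall>j<length ns. Fs ! j \<in> carrier_mat (ns ! j) (ns ! j) \<and> invertible_mat (Fs ! j)"
      unfolding block_scalings_def by blast
    then have Fs: "list_all2 (\<lambda>M k. M \<in> carrier_mat k k) Fs ns"
      and "list_all2 (\<lambda>M k. M \<in> carrier_mat k k \<and> det M \<noteq> 0) Fs ns"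
      by (auto simp: list_all2_conv_all_nth invertible_mat_iff_det)
    then have dF: "det E \<noteq> 0" and F: "E \<in> carrier_mat n n"
      using det_diag_block_mat_nonzero diag_block_mat_carrier assms(5) unfolding E by blast+
    have "1 \<le> omega (transpose_mat (E * ?L) * (E * ?L))"
      using F L dF dL assms(1) by (intro omega_gram_ge_1[of _ n]) (auto simp: det_mult)
    moreover have "0 \<le> ?c" using assms(1) by (simp add: real_root_ge_zero)
    ultimately show ?thesis
      unfolding E omega[OF Fs] by (metis mult_1 mult_right_mono)
  qed
  \<comment> \<open>\<open>is_arg_min\<close> forbids strictly smaller feasible values; in a linear
    order this is the lower bound just shown.\<close>
  ultimately show ?thesis
    using blocks unfolding is_arg_min_def opt by (auto simp: not_less)
qed

end
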